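(* Let $\mathcal{C}$ be a sum closed permutation class. Let $F(x)=\sum_{n\ge0}f_nx^n$, $\widetilde F(x)=\sum_{n\ge1}\widetilde f_nx^n$ and $G(x)=\sum_{n\ge1}g_nx^n$, where $f_n=|\mathcal{C}_n|$ (so $f_0=1$), $\widetilde f_n=|\oplus\mathcal{C}_n|$, and $g_n$ is the number of indecomposable permutations in $\mathcal{C}_n$. Then, as formal power series, \[\widetilde F(x)=x\,G'(x)\,F(x)=\frac{xF'(x)}{F(x)}=x\frac{d}{dx}\log F(x).\]
   Context: A permutation class is a set of finite permutations closed under containment; $\mathcal{C}_n=\mathcal{C}\cap S_n$. For $\sigma\in S_a$ and $\tau\in S_b$, $\sigma\oplus\tau\in S_{a+b}$ equals $\sigma(i)$ for $i\le a$ and $a+\tau(i-a)$ for $i>a$. The class is sum closed if it is closed under $\oplus$. A permutation is indecomposable if it is not a sum of two permutations of nonzero size. For $\pi\in S_n$, $\oplus\pi(i+kn)=\pi(i)+kn$ for $i\in[n]$ and $k\in\mathbb{Z}$. The shift is $\Sigma^r\sigma(i)=\sigma(i-r)+r$. We set $\oplus\mathcal{C}_n=\{\Sigma^r(\oplus\pi):\pi\in\mathcal{C}_n,\ r\in\mathbb{Z}\}$, viewed as a set of bijections $\mathbb{Z}\to\mathbb{Z}$. *)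

theory Defs
  imports
    "HOL-Combinatorics.Permutations"
    "HOL-Computational_Algebra.Formal_Power_Series"
begin

(* A permutation of size n is a pair (n, p) where p permutes {1..n}, so p is the identity outside
   {1..n}.  The size has to be recorded because p then also permutes {1..n + 1}. *)
type_synonym sized_perm = "nat \<times> (int \<Rightarrow> int)"

definition perms :: "sized_perm set" where
  "perms = {(n, p). p permutes {1..int n}}"

fun perm_contained :: "sized_perm \<Rightarrow> sized_perm \<Rightarrow> bool" where
  "perm_contained (k, q) (n, p) \<longleftrightarrow>
     (\<exists>e. strict_mono_on {1..int k} e \<and> e ` {1..int k} \<subseteq> {1..int n} \<and>
          (\<forall>i\<in>{1..int k}. \<forall>j\<in>{1..int k}. q i < q j \<longleftrightarrow> p (e i) < p (e j)))"

(* Classes are nonempty, equivalently contain the permutation of size 0 (see level_0 below). *)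
definition perm_class :: "sized_perm set \<Rightarrow> bool" where
  "perm_class C \<longleftrightarrow> C \<noteq> {} \<and> C \<subseteq> perms \<and>
     (\<forall>P\<in>C. \<forall>Q\<in>perms. perm_contained Q P \<longrightarrow> Q \<in> C)"

definition level :: "sized_perm set \<Rightarrow> nat \<Rightarrow> (int \<Rightarrow> int) set" where
  "level C n = {p. (n, p) \<in> C}"

fun perm_sum :: "sized_perm \<Rightarrow> sized_perm \<Rightarrow> sized_perm" where
  "perm_sum (a, s) (b, t) = (a + b, \<lambda>i. if i \<le> int a then s i else int a + t (i - int a))"

definition sum_closed :: "sized_perm set \<Rightarrow> bool" where
  "sum_closed C \<longleftrightarrow> (\<forall>P\<in>C. \<forall>Q\<in>C. perm_sum P Q \<in> C)"

definition indecomposable :: "sized_perm \<Rightarrow> bool" where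
  "indecomposable P \<longleftrightarrow>
     \<not> (\<exists>Q\<in>perms. \<exists>R\<in>perms. fst Q \<noteq> 0 \<and> fst R \<noteq> 0 \<and> P = perm_sum Q R)"

(* Every m is uniquely i + k * n with i in {1..n}, namely for i = (m - 1) mod n + 1 and
   k = (m - 1) div n; the defining equation is oplus_perm_eq below. *)
definition oplus_perm :: "nat \<Rightarrow> (int \<Rightarrow> int) \<Rightarrow> int \<Rightarrow> int" where
  "oplus_perm n p m = p ((m - 1) mod int n + 1) + (m - 1) div int n * int n"

definition shift :: "int \<Rightarrow> (int \<Rightarrow> int) \<Rightarrow> int \<Rightarrow> int" where
  "shift r s i = s (i - r) + r"

definition oplus_level :: "sized_perm set \<Rightarrow> nat \<Rightarrow> (int \<Rightarrow> int) set" where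
  "oplus_level C n = {shift r (oplus_perm n p) | r p. p \<in> level C n}"

(* fps_ln 1 is the series of log (1 + x), so this is log F for F with constant coefficient 1. *)
definition fps_log :: "'a::field_char_0 fps \<Rightarrow> 'a fps" where
  "fps_log F = fps_ln 1 oo (F - 1)"

lemma oplus_perm_eq:
  assumes "i \<in> {1..int n}"
  shows "oplus_perm n p (i + k * int n) = p i + k * int n"
proof -
  have "(i + k * int n - 1) mod int n = i - 1"
    using assms by (simp add: diff_add_eq[symmetric])
  moreover have "(i + k * int n - 1) div int n = k"
    using assms by (simp add: diff_add_eq[symmetric])
  ultimately show ?thesis
    by (simp add: oplus_perm_def)
qed

lemma level_0:
  assumes "perm_class C"
  shows "level C 0 = {id}"
proof -
  obtain P where P: "P \<in> C"
    using assms by (auto simp: perm_class_def)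
  have "perm_contained (0, id) P"
    by (cases P) (auto simp: strict_mono_on_def)
  moreover have "(0, id) \<in> perms"
    by (simp add: perms_def)
  ultimately have "(0, id) \<in> C"
    using assms P by (auto simp: perm_class_def)
  moreover have "p = id" if "(0, p) \<in> C" for p
    using assms that by (auto simp: perm_class_def perms_def)
  ultimately show ?thesis
    by (auto simp: level_def)
qed

lemma finite_level:
  assumes "perm_class C"
  shows "finite (level C n)"
proof (rule finite_subset)
  show "level C n \<subseteq> {p. p permutes {1..int n}}"
    using assms by (auto simp: perm_class_def perms_def level_def)
qed (simp add: finite_permutations)

lemma bij_oplus_level:
  assumes "perm_class C" "n > 0" "f \<in> oplus_level C n"
  shows "bij f"
proof -
  obtain r p where f: "f = shift r (oplus_perm n p)" and "p \<in> level C n"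
    using assms(3) by (auto simp: oplus_level_def)
  then have p: "p permutes {1..int n}"
    using assms(1) by (auto simp: perm_class_def perms_def level_def)
  let ?q = "inv p"
  have q: "?q permutes {1..int n}"
    using p by (rule permutes_inv)
  have inv: "oplus_perm n u (oplus_perm n v m) = m"
    if v: "v permutes {1..int n}" and uv: "\<And>i. u (v i) = i" for u v m
  proof -
    define i where "i = (m - 1) mod int n + 1"
    define k where "k = (m - 1) div int n"
    have i: "i \<in> {1..int n}"
      using assms(2) pos_mod_bound[of "int n" "m - 1"] pos_mod_sign[of "int n" "m - 1"]
      unfolding i_def atLeastAtMost_iff by linarith
    have m: "m = i + k * int n"
      using div_mult_mod_eq[of "m - 1" "int n"] unfolding i_def k_def by linarith
    have "v i \<in> {1..int n}"
      using i permutes_in_image[OF v] by blast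
    then show ?thesis
      unfolding m oplus_perm_eq[OF i] by (simp add: oplus_perm_eq uv)
  qed
  have "bij (oplus_perm n p)"
    by (rule o_bij[of "oplus_perm n ?q"])
       (auto simp: fun_eq_iff inv[OF p] inv[OF q] permutes_inverses[OF p])
  moreover have "f = (\<lambda>x. x + r) \<circ> oplus_perm n p \<circ> (\<lambda>x. x - r)"
    by (simp add: f shift_def fun_eq_iff)
  moreover have "bij (\<lambda>x::int. x + r)"
    by (rule o_bij[of "\<lambda>x. x - r"]) (auto simp: fun_eq_iff)
  moreover have "bij (\<lambda>x::int. x - r)"
    by (rule o_bij[of "\<lambda>x. x + r"]) (auto simp: fun_eq_iff)
  ultimately show ?thesis
    by (simp add: bij_comp)
qed

lemma finite_oplus_level:
  assumes "perm_class C" "n > 0"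
  shows "finite (oplus_level C n)"
proof (rule finite_subset)
  have red: "shift r (oplus_perm n p) = shift (r mod int n) (oplus_perm n p)" for r p
  proof
    fix m
    define k where "k = r div int n"
    have r: "r = r mod int n + k * int n"
      using div_mult_mod_eq[of r "int n"] unfolding k_def by linarith
    have "oplus_perm n p (x - k * int n) = oplus_perm n p x - k * int n" for x
    proof -
      have e: "x - k * int n - 1 = (x - 1) + (- k) * int n" by simp
      have "((x - 1) + (- k) * int n) mod int n = (x - 1) mod int n"
        by (rule mod_mult_self1)
      moreover have "((x - 1) + (- k) * int n) div int n = - k + (x - 1) div int n"
        using assms(2) by (intro div_mult_self1) simp
      ultimately show ?thesis
        unfolding oplus_perm_def e by (simp only: algebra_simps)
    qed
    from this[of "m - r mod int n"]
    show "shift r (oplus_perm n p) m = shift (r mod int n) (oplus_perm n p) m"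
      unfolding shift_def using r by (smt (verit))
  qed
  show "oplus_level C n \<subseteq>
      (\<lambda>(r, p). shift r (oplus_perm n p)) ` ({0..<int n} \<times> level C n)"
  proof
    fix f
    assume "f \<in> oplus_level C n"
    then obtain r p where "f = shift r (oplus_perm n p)" and p: "p \<in> level C n"
      by (auto simp: oplus_level_def)
    then have "f = (\<lambda>(r, p). shift r (oplus_perm n p)) (r mod int n, p)"
      using red by simp
    moreover have "(r mod int n, p) \<in> {0..<int n} \<times> level C n"
      using assms(2) p by simp
    ultimately show "f \<in> (\<lambda>(r, p). shift r (oplus_perm n p)) ` ({0..<int n} \<times> level C n)"
      by (rule image_eqI)
  qed
qed (simp add: finite_level[OF assms(1)])

end

theory Submission
  imports Defs
begin

text \<open>
  Every permutation of positive size is uniquely \<open>q \<oplus> t\<close> with \<open>q\<close> indecomposable of positive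
  size; call the size of \<open>q\<close> the first block.  In a sum closed class this gives \<open>F = 1 + G F\<close>.
  An element of \<open>\<oplus>\<C>\<^sub>n\<close> is determined by the block of it that contains position \<open>1\<close>, together
  with the offset of position \<open>1\<close> in that block: it is \<open>\<Sigma>\<^sup>-\<^sup>j(\<oplus>p)\<close> for exactly one \<open>p \<in> \<C>\<^sub>n\<close> and
  one \<open>j\<close> smaller than the first block of \<open>p\<close>.  Hence its cardinality is the sum of the first blocks,
  which is the coefficient of \<open>x\<^sup>n\<close> in \<open>x G' F\<close>.
\<close>

section \<open>Cuts and the first block of a permutation\<close>

text \<open>For \<open>p\<close> permuting \<open>{1..int n}\<close> and \<open>d \<le> n\<close>,
  injectivity upgrades this bound to \<open>p\<close> mapping \<open>{1..int d}\<close> onto itself,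
  so cuts mark the places where \<open>p\<close> splits as a sum.\<close>

definition cut :: "(int \<Rightarrow> int) \<Rightarrow> nat \<Rightarrow> bool" where
  "cut p d \<longleftrightarrow> (\<forall>i\<in>{1..int d}. p i \<le> int d)"

text \<open>The size is not an argument: for positive size \<open>n\<close>, \<open>n\<close> itself
  is a cut, so the minimum exists and is at most \<open>n\<close>. The permutation of size 0 gets
  the value 1, hence the restriction to positive sizes below.\<close>

definition first_block :: "(int \<Rightarrow> int) \<Rightarrow> nat" where
  "first_block p = (LEAST d. 0 < d \<and> cut p d)"

lemma level_permutes: "perm_class C \<Longrightarrow> p \<in> level C n \<Longrightarrow> p permutes {1..int n}"
  by (auto simp: perm_class_def perms_def level_def)

lemma permutes_bounds:
  assumes "p permutes {1..int n}" "1 \<le> i" "i \<le> int n"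
  shows "1 \<le> p i" "p i \<le> int n"
  using permutes_in_image[OF assms(1), of i] assms(2,3) by auto

lemma permutes_fixes: "p permutes {1..int n} \<Longrightarrow> i < 1 \<or> int n < i \<Longrightarrow> p i = i"
  by (rule permutes_not_in) auto

lemma cut_size: "p permutes {1..int n} \<Longrightarrow> cut p n"
  by (auto simp: cut_def permutes_bounds)

lemma first_block:
  assumes "p permutes {1..int n}" "0 < n"
  shows "0 < first_block p" "first_block p \<le> n" "cut p (first_block p)"
    and "\<And>d. 0 < d \<Longrightarrow> cut p d \<Longrightarrow> first_block p \<le> d"
proof -
  have "0 < n \<and> cut p n"
    using assms cut_size by blast
  from LeastI[of "\<lambda>d. 0 < d \<and> cut p d", OF this] Least_le[of "\<lambda>d. 0 < d \<and> cut p d", OF this]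
  show "0 < first_block p" "first_block p \<le> n" "cut p (first_block p)"
    unfolding first_block_def by auto
  show "\<And>d. 0 < d \<Longrightarrow> cut p d \<Longrightarrow> first_block p \<le> d"
    unfolding first_block_def by (rule Least_le) simp
qed

section \<open>Sums, cuts and indecomposability\<close>

lemma perm_sum_eq_iff:
  assumes "s permutes {1..int a}" "s' permutes {1..int a}"
    and "t permutes {1..int b}" "t' permutes {1..int b}"
  shows "perm_sum (a, s) (b, t) = perm_sum (a, s') (b, t') \<longleftrightarrow> s = s' \<and> t = t'"
proof
  assume eq: "perm_sum (a, s) (b, t) = perm_sum (a, s') (b, t')"
  have "s i = s' i" for i
    using fun_cong[OF eq[simplified], of i]
      permutes_fixes[OF assms(1), of i] permutes_fixes[OF assms(2), of i]
    by (cases "i \<le> int a") auto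
  moreover have "t i = t' i" for i
    using fun_cong[OF eq[simplified], of "i + int a"]
      permutes_fixes[OF assms(3), of i] permutes_fixes[OF assms(4), of i]
    by (cases "1 \<le> i") auto
  ultimately show "s = s' \<and> t = t'" by auto
qed simp

lemma cut_perm_sum: "d \<le> a \<Longrightarrow> cut (snd (perm_sum (a, s) (b, t))) d \<longleftrightarrow> cut s d"
  by (auto simp: cut_def)

text \<open>An injection of the finite set \<open>{1..int d}\<close> into itself is onto, so
  \<open>p\<close> also preserves the complement \<open>{int d + 1..int n}\<close>. The two
  restrictions, the second moved down by \<open>d\<close>, are the summands.\<close>

lemma cut_decomposition:
  assumes p: "p permutes {1..int n}" and d: "d \<le> n" and c: "cut p d"
  obtains u v where "u permutes {1..int d}" "v permutes {1..int (n - d)}"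
    "(n, p) = perm_sum (d, u) (n - d, v)"
proof
  have img: "p ` {1..int d} = {1..int d}"
  proof (rule endo_inj_surj)
    show "p ` {1..int d} \<subseteq> {1..int d}"
      using c d permutes_bounds[OF p] by (force simp: cut_def)
    show "inj_on p {1..int d}"
      using permutes_inj[OF p] by (rule inj_on_subset) simp
  qed simp
  have img': "p ` {int d + 1..int n} = {int d + 1..int n}"
  proof -
    have e: "{int d + 1..int n} = {1..int n} - {1..int d}" by auto
    show ?thesis
      unfolding e image_set_diff[OF permutes_inj[OF p]] img permutes_image[OF p] ..
  qed
  let ?u = "\<lambda>i. if i \<in> {1..int d} then p i else i"
  let ?v = "\<lambda>i. if i \<in> {1..int (n - d)} then p (i + int d) - int d else i"
  show "?u permutes {1..int d}"
  proof (rule bij_imp_permutes)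
    have "bij_betw p {1..int d} {1..int d}"
      using img permutes_inj[OF p] by (auto simp: bij_betw_def intro: inj_on_subset)
    then show "bij_betw ?u {1..int d} {1..int d}"
      by (subst bij_betw_cong[of _ _ p]) auto
  qed auto
  show "?v permutes {1..int (n - d)}"
  proof (rule bij_imp_permutes)
    have "bij_betw p {int d + 1..int n} {int d + 1..int n}"
      using img' permutes_inj[OF p] by (auto simp: bij_betw_def intro: inj_on_subset)
    moreover have "bij_betw (\<lambda>i. i + int d) {1..int (n - d)} {int d + 1..int n}"
      using d by (intro bij_betw_byWitness[where f' = "\<lambda>i. i - int d"]) auto
    moreover have "bij_betw (\<lambda>i. i - int d) {int d + 1..int n} {1..int (n - d)}"
      using d by (intro bij_betw_byWitness[where f' = "\<lambda>i. i + int d"]) auto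
    ultimately have "bij_betw ((\<lambda>i. i - int d) \<circ> p \<circ> (\<lambda>i. i + int d)) {1..int (n - d)} {1..int (n - d)}"
      by (blast intro: bij_betw_trans)
    then show "bij_betw ?v {1..int (n - d)} {1..int (n - d)}"
      by (subst bij_betw_cong[of _ _ "(\<lambda>i. i - int d) \<circ> p \<circ> (\<lambda>i. i + int d)"]) auto
  qed auto
  show "(n, p) = perm_sum (d, ?u) (n - d, ?v)"
    using d permutes_fixes[OF p] by (auto simp: fun_eq_iff of_nat_diff)
qed

lemma perm_contained_perm_sum:
  shows "perm_contained (a, u) (perm_sum (a, u) (b, v))"
    and "perm_contained (b, v) (perm_sum (a, u) (b, v))"
proof -
  show "perm_contained (a, u) (perm_sum (a, u) (b, v))"
    by (auto simp: strict_mono_on_def intro!: exI[of _ "\<lambda>i. i"])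
  show "perm_contained (b, v) (perm_sum (a, u) (b, v))"
    by (auto simp: strict_mono_on_def intro!: exI[of _ "\<lambda>i. i + int a"])
qed

text \<open>Each summand is contained in the sum, so closure under containment gives one direction;
  sum closure gives the other.\<close>

lemma perm_sum_in_class_iff:
  assumes C: "perm_class C" "sum_closed C"
    and u: "u permutes {1..int a}" and v: "v permutes {1..int b}"
  shows "perm_sum (a, u) (b, v) \<in> C \<longleftrightarrow> u \<in> level C a \<and> v \<in> level C b"
proof
  assume "perm_sum (a, u) (b, v) \<in> C"
  moreover have "(a, u) \<in> perms" "(b, v) \<in> perms"
    using u v by (auto simp: perms_def)
  ultimately show "u \<in> level C a \<and> v \<in> level C b"
    using C(1) perm_contained_perm_sum(1)[of a u b v] perm_contained_perm_sum(2)[of b v a u] unfolding perm_class_def level_def by blast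
next
  assume "u \<in> level C a \<and> v \<in> level C b"
  then show "perm_sum (a, u) (b, v) \<in> C"
    using C(2) unfolding sum_closed_def level_def by blast
qed

text \<open>Cuts strictly between 0 and \<open>n\<close> correspond to decompositions into two
  nonempty summands.\<close>

lemma indecomposable_iff:
  assumes p: "p permutes {1..int n}" and "0 < n"
  shows "indecomposable (n, p) \<longleftrightarrow> first_block p = n"
proof
  assume ind: "indecomposable (n, p)"
  let ?d = "first_block p"
  obtain u v where uv: "u permutes {1..int ?d}" "v permutes {1..int (n - ?d)}"
    "(n, p) = perm_sum (?d, u) (n - ?d, v)"
    using cut_decomposition[OF p first_block(2,3)[OF assms]] .
  have "(?d, u) \<in> perms" "(n - ?d, v) \<in> perms"
    using uv by (auto simp: perms_def)
  then have "n - ?d = 0"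
    using ind uv(3) first_block(1)[OF assms] unfolding indecomposable_def by fastforce
  then show "?d = n"
    using first_block(2)[OF assms] by simp
next
  assume n: "first_block p = n"
  show "indecomposable (n, p)"
    unfolding indecomposable_def
  proof
    assume "\<exists>Q\<in>perms. \<exists>R\<in>perms. fst Q \<noteq> 0 \<and> fst R \<noteq> 0 \<and> (n, p) = perm_sum Q R"
    then obtain a u b v where q: "(a, u) \<in> perms" "fst (a, u) \<noteq> 0" "fst (b, v) \<noteq> 0"
      "(n, p) = perm_sum (a, u) (b, v)"
      by (metis prod.exhaust)
    have "cut p a"
      using cut_perm_sum[of a a u b v] cut_size[of u a] q(1,4)
      by (metis case_prodD mem_Collect_eq order_refl perms_def snd_conv)
    then show False
      using first_block(4)[OF assms, of a] n q by auto
  qed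
qed

lemma first_block_perm_sum:
  assumes "u permutes {1..int a}" "0 < a" "first_block u = a"
  shows "first_block (snd (perm_sum (a, u) (b, v))) = a"
  unfolding first_block_def
proof (rule Least_equality)
  show "0 < a \<and> cut (snd (perm_sum (a, u) (b, v))) a"
    using assms cut_perm_sum cut_size by blast
  show "a \<le> d" if "0 < d \<and> cut (snd (perm_sum (a, u) (b, v))) d" for d
    using that first_block(4)[OF assms(1,2), of d] assms(3) cut_perm_sum[of d a u b v]
    by (cases "d \<le> a") auto
qed

section \<open>Counting a sum closed class by first block\<close>

text \<open>Splitting off the first block inverts the map sending \<open>(u, v)\<close> to the sum
  of \<open>u\<close> and \<open>v\<close>, where \<open>u\<close> is indecomposable of size
  \<open>k\<close> and \<open>v\<close> is arbitrary of size \<open>n - k\<close>.\<close>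

lemma card_first_block:
  assumes C: "perm_class C" "sum_closed C" and k: "0 < k" "k \<le> n"
  shows "card {p \<in> level C n. first_block p = k} =
    card {p \<in> level C k. indecomposable (k, p)} * card (level C (n - k))"
proof -
  let ?I = "{p \<in> level C k. indecomposable (k, p)}"
  let ?f = "\<lambda>(u, v). snd (perm_sum (k, u) (n - k, v))"
  note lp = level_permutes[OF C(1)]
  have "bij_betw ?f (?I \<times> level C (n - k)) {p \<in> level C n. first_block p = k}"
    unfolding bij_betw_def
  proof
    show "inj_on ?f (?I \<times> level C (n - k))"
    proof (rule inj_onI, safe)
      fix u v u' v'
      assume *: "u \<in> level C k" "u' \<in> level C k" "v \<in> level C (n - k)" "v' \<in> level C (n - k)"
        "snd (perm_sum (k, u) (n - k, v)) = snd (perm_sum (k, u') (n - k, v'))"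
      then have "perm_sum (k, u) (n - k, v) = perm_sum (k, u') (n - k, v')" by simp
      then show "u = u'" "v = v'"
        using perm_sum_eq_iff * lp by metis+
    qed
    show "?f ` (?I \<times> level C (n - k)) = {p \<in> level C n. first_block p = k}"
    proof (intro equalityI subsetI)
      fix p
      assume "p \<in> ?f ` (?I \<times> level C (n - k))"
      then obtain u v where *: "u \<in> level C k" "indecomposable (k, u)" "v \<in> level C (n - k)"
        and p: "p = snd (perm_sum (k, u) (n - k, v))"
        by (elim imageE SigmaE) auto
      then have "perm_sum (k, u) (n - k, v) \<in> C"
        using perm_sum_in_class_iff[OF C] lp by blast
      then have "p \<in> level C n"
        using k by (simp add: level_def p)
      moreover have "first_block (snd (perm_sum (k, u) (n - k, v))) = k"
        using first_block_perm_sum[of u k] indecomposable_iff[of u k] * lp k by blast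
      ultimately show "p \<in> {p \<in> level C n. first_block p = k}"
        by (simp only: p mem_Collect_eq)
    next
      fix p
      assume "p \<in> {p \<in> level C n. first_block p = k}"
      then have p: "p \<in> level C n" and f: "k = first_block p"
        by auto
      have "0 < n" using k by simp
      then obtain u v where uv: "u permutes {1..int k}" "v permutes {1..int (n - k)}"
        "(n, p) = perm_sum (k, u) (n - k, v)"
        using cut_decomposition[of p n k] first_block[of p n] lp[OF p] f by metis
      have "perm_sum (k, u) (n - k, v) \<in> C"
        using p uv(3) by (simp add: level_def)
      then have l: "u \<in> level C k" "v \<in> level C (n - k)"
        using perm_sum_in_class_iff[OF C uv(1,2)] by auto
      have ps: "p = snd (perm_sum (k, u) (n - k, v))"
        using uv(3) by (metis snd_conv)
      \<comment> \<open>A cut of \<open>u\<close> is a cut of \<open>p\<close>, so minimality of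
        \<open>k\<close> leaves \<open>u\<close> no cut smaller than its size.\<close>
      have "cut p (first_block u)"
        using cut_perm_sum[OF first_block(2)[OF uv(1) k(1)]] first_block(3)[OF uv(1) k(1)]
        unfolding ps by blast
      then have "first_block u = k"
        using first_block[OF uv(1) k(1)] first_block(4)[OF lp[OF p] \<open>0 < n\<close>, of "first_block u"] f
        by simp
      then have "indecomposable (k, u)"
        using indecomposable_iff[OF uv(1) k(1)] by simp
      then show "p \<in> ?f ` (?I \<times> level C (n - k))"
        using l ps by (intro image_eqI[of _ _ "(u, v)"]) auto
    qed
  qed
  then show ?thesis
    by (simp add: bij_betw_same_card[symmetric] card_cartesian_product)
qed

text \<open>The weight \<open>h\<close> serves two purposes: constant weight 1 gives the recurrence
  behind \<open>F = 1 + G * F\<close>, and \<open>of_nat\<close> gives the cardinality of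
  \<open>oplus_level C n\<close>.\<close>

lemma sum_first_block:
  fixes h :: "nat \<Rightarrow> 'a::comm_semiring_1"
  assumes C: "perm_class C" "sum_closed C" and n: "0 < n"
  shows "(\<Sum>p\<in>level C n. h (first_block p)) =
    (\<Sum>k=1..n. h k * of_nat (card {p \<in> level C k. indecomposable (k, p)} * card (level C (n - k))))"
proof -
  have "first_block ` level C n \<subseteq> {1..n}"
    using first_block(1,2)[OF level_permutes[OF C(1)] n] by force
  then have "(\<Sum>p\<in>level C n. h (first_block p)) =
      (\<Sum>k=1..n. \<Sum>p\<in>{p \<in> level C n. first_block p = k}. h (first_block p))"
    by (intro sum.group[symmetric]) (auto simp: finite_level[OF C(1)])
  also have "\<dots> = (\<Sum>k=1..n. h k * of_nat (card {p \<in> level C n. first_block p = k}))"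
    by (intro sum.cong) (auto simp: mult.commute)
  also have "\<dots> = (\<Sum>k=1..n. h k *
      of_nat (card {p \<in> level C k. indecomposable (k, p)} * card (level C (n - k))))"
    by (intro sum.cong refl) (subst card_first_block[OF C], auto)
  finally show ?thesis .
qed

section \<open>Shifts of periodic bijections\<close>

lemma residue_decomposition:
  assumes "0 < n"
  obtains i k where "m = i + k * int n" "1 \<le> i" "i \<le> int n"
proof
  show "m = ((m - 1) mod int n + 1) + (m - 1) div int n * int n"
    using div_mult_mod_eq[of "m - 1" "int n"] by linarith
  show "1 \<le> (m - 1) mod int n + 1" "(m - 1) mod int n + 1 \<le> int n"
    using assms pos_mod_bound[of "int n" "m - 1"] pos_mod_sign[of "int n" "m - 1"] by linarith+
qed

lemma shift_shift: "shift r (shift r' s) = shift (r + r') s"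
  by (simp add: shift_def fun_eq_iff algebra_simps)

lemma shift_0 [simp]: "shift 0 s = s"
  by (simp add: shift_def fun_eq_iff)

lemma shift_multiple_oplus_perm:
  assumes "0 < n"
  shows "shift (k * int n) (oplus_perm n p) = oplus_perm n p"
proof
  fix m
  obtain i l where m: "m = i + l * int n" "1 \<le> i" "i \<le> int n"
    using residue_decomposition[OF assms] .
  show "shift (k * int n) (oplus_perm n p) m = oplus_perm n p m"
    using oplus_perm_eq[of i n p l] oplus_perm_eq[of i n p "l - k"] m
    by (simp add: shift_def algebra_simps)
qed

text \<open>Moving the origin past the first summand rotates the periodic sequence of blocks, so a
  period now starts with \<open>v\<close> and ends with \<open>u\<close>.\<close>

lemma shift_oplus_perm_sum:
  assumes "0 < a + b"
  shows "shift (- int a) (oplus_perm (a + b) (snd (perm_sum (a, u) (b, v)))) =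
    oplus_perm (a + b) (snd (perm_sum (b, v) (a, u)))"
proof
  fix m
  obtain i k where m: "m = i + k * int (a + b)" "1 \<le> i" "i \<le> int (a + b)"
    using residue_decomposition[OF assms] .
  show "shift (- int a) (oplus_perm (a + b) (snd (perm_sum (a, u) (b, v)))) m =
    oplus_perm (a + b) (snd (perm_sum (b, v) (a, u))) m"
  proof (cases "i \<le> int b")
    case True
    then show ?thesis
      using m oplus_perm_eq[of "i + int a" "a + b" "snd (perm_sum (a, u) (b, v))" k]
        oplus_perm_eq[of i "a + b" "snd (perm_sum (b, v) (a, u))" k]
      by (simp add: shift_def algebra_simps)
  next
    case False
    then show ?thesis
      \<comment> \<open>Here \<open>i + int a\<close> has passed the end of the period and lies in
        the copy of \<open>u\<close> of the next one, hence \<open>k + 1\<close>.\<close>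
      using m oplus_perm_eq[of "i - int b" "a + b" "snd (perm_sum (a, u) (b, v))" "k + 1"]
        oplus_perm_eq[of i "a + b" "snd (perm_sum (b, v) (a, u))" k]
      by (simp add: shift_def algebra_simps)
  qed
qed

text \<open>Each period is mapped to itself, and a position \<open>m \<le> 0\<close> lies in a
  period of index \<open>k \<le> -1\<close>, which ends at or before 0.\<close>

lemma oplus_perm_nonpos:
  assumes p: "p permutes {1..int n}" and n: "0 < n" and m: "m \<le> 0"
  shows "oplus_perm n p m \<le> 0"
proof -
  obtain i k where ik: "m = i + k * int n" "1 \<le> i" "i \<le> int n"
    using residue_decomposition[OF n] .
  have "k * int n < 0" using ik m by linarith
  then have "k + 1 \<le> 0" using n by (simp add: mult_less_0_iff)
  then have "(k + 1) * int n \<le> 0" by (rule mult_nonpos_nonneg) simp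
  moreover have "p i \<le> int n" using permutes_bounds[OF p] ik by blast
  ultimately show ?thesis
    using oplus_perm_eq[of i n p k] ik by (simp add: algebra_simps)
qed

lemma oplus_perm_inj:
  assumes p: "p permutes {1..int n}" and p': "p' permutes {1..int n}"
    and eq: "oplus_perm n p = oplus_perm n p'"
  shows "p = p'"
proof
  fix i
  show "p i = p' i"
    using oplus_perm_eq[of i n p 0] oplus_perm_eq[of i n p' 0] eq
      permutes_fixes[OF p, of i] permutes_fixes[OF p', of i]
    by (cases "i \<in> {1..int n}") auto
qed

text \<open>Moving the origin of \<open>\<oplus>p'\<close> by \<open>j' - j\<close> gives \<open>\<oplus>p\<close>, which is cut at the origin; so a positive
  \<open>j' - j\<close> would be a cut of \<open>p'\<close> before the end of its first block.\<close>

lemma shift_oplus_perm_le: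
  assumes p: "p permutes {1..int n}" and p': "p' permutes {1..int n}" and n: "0 < n"
    and j': "j' < first_block p'"
    and eq: "shift (- int j) (oplus_perm n p) = shift (- int j') (oplus_perm n p')"
  shows "j' \<le> j"
proof (rule ccontr)
  assume "\<not> j' \<le> j"
  define d where "d = j' - j"
  have d: "0 < d" "d < first_block p'" "int d = int j' - int j"
    using \<open>\<not> j' \<le> j\<close> j' by (auto simp: d_def)
  have "cut p' d"
    unfolding cut_def
  proof
    fix i
    assume i: "i \<in> {1..int d}"
    then have "i \<in> {1..int n}"
      using d first_block(2)[OF p' n] by auto
    then have "p' i = oplus_perm n p' i"
      using oplus_perm_eq[of i n p' 0] by simp
    also have "\<dots> = oplus_perm n p (i - int d) + int d"
    proof -
      \<comment> \<open>At the argument \<open>i - int j'\<close> the right side of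
        \<open>eq\<close> reads \<open>p'\<close> at \<open>i\<close>, and the left side reads
        \<open>p\<close> at \<open>i - int d\<close>, which is nonpositive.\<close>
      have "i - int j' - - int j = i - int d" "i - int j' - - int j' = i"
        using d(3) by simp_all
      then have "oplus_perm n p (i - int d) + - int j = oplus_perm n p' i + - int j'"
        using fun_cong[OF eq, of "i - int j'"] unfolding shift_def by (simp only:)
      then show ?thesis
        using d(3) by linarith
    qed
    also have "\<dots> \<le> int d"
      using oplus_perm_nonpos[OF p n, of "i - int d"] i by simp
    finally show "p' i \<le> int d" .
  qed
  then show False
    using first_block(4)[OF p' n d(1)] d(2) by simp
qed

text \<open>Induction on \<open>r\<close>: while \<open>r\<close> is at least the first block, that
  block is rotated to the end, which uses up its size from the shift. The rotated permutation stays
  in \<open>C\<close> because both summands lie in \<open>C\<close> and \<open>C\<close> is sum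
  closed.\<close>

lemma shift_oplus_perm_normal_form:
  assumes C: "perm_class C" "sum_closed C" and n: "0 < n" and p: "p \<in> level C n"
  shows "\<exists>p'\<in>level C n. \<exists>j<first_block p'.
    shift (- int r) (oplus_perm n p) = shift (- int j) (oplus_perm n p')"
  using p
proof (induction r arbitrary: p rule: less_induct)
  case (less r)
  let ?d = "first_block p"
  note pp = level_permutes[OF C(1) less.prems]
  note fb = first_block[OF pp n]
  show ?case
  proof (cases "r < ?d")
    case True
    then show ?thesis using less.prems by blast
  next
    case False
    obtain u v where uv: "u permutes {1..int ?d}" "v permutes {1..int (n - ?d)}"
      "(n, p) = perm_sum (?d, u) (n - ?d, v)"
      using cut_decomposition[OF pp fb(2,3)] .
    let ?p = "snd (perm_sum (n - ?d, v) (?d, u))"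
    have "perm_sum (?d, u) (n - ?d, v) \<in> C"
      using less.prems uv(3) by (simp only: level_def mem_Collect_eq)
    then have "perm_sum (n - ?d, v) (?d, u) \<in> C"
      using perm_sum_in_class_iff[OF C] uv(1,2) by blast
    then have "?p \<in> level C n"
      using fb(2) by (simp add: level_def)
    moreover have "r - ?d < r"
      using False fb(1) by simp
    ultimately obtain p' j where p': "p' \<in> level C n" "j < first_block p'"
      "shift (- int (r - ?d)) (oplus_perm n ?p) = shift (- int j) (oplus_perm n p')"
      using less.IH by blast
    have "shift (- int ?d) (oplus_perm n p) = oplus_perm n ?p"
      using shift_oplus_perm_sum[of ?d "n - ?d" u v] fb(2) n uv(3)
      by (metis le_add_diff_inverse snd_conv)
    then have "shift (- int (r - ?d)) (oplus_perm n ?p) =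
        shift (- int (r - ?d)) (shift (- int ?d) (oplus_perm n p))"
      by simp
    also have "\<dots> = shift (- int r) (oplus_perm n p)"
      using False by (simp add: shift_shift of_nat_diff)
    finally show ?thesis
      using p' by metis
  qed
qed

section \<open>The cardinality of the periodic level\<close>

text \<open>The pairs of \<open>p\<close> and an offset \<open>j\<close> below its first block
  parametrize \<open>oplus_level C n\<close> bijectively: the normal form gives surjectivity, and
  comparing offsets in both directions gives injectivity.\<close>

lemma card_oplus_level:
  assumes C: "perm_class C" "sum_closed C" and n: "0 < n"
  shows "card (oplus_level C n) = (\<Sum>p\<in>level C n. first_block p)"
proof -
  let ?f = "\<lambda>(p, j). shift (- int j) (oplus_perm n p)"
  note lp = level_permutes[OF C(1)]
  have "bij_betw ?f (SIGMA p:level C n. {..<first_block p}) (oplus_level C n)"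
    unfolding bij_betw_def
  proof
    show "inj_on ?f (SIGMA p:level C n. {..<first_block p})"
    proof -
      have "p = p' \<and> j = j'" if *: "p \<in> level C n" "p' \<in> level C n" "j \<in> {..<first_block p}"
        "j' \<in> {..<first_block p'}"
        "shift (- int j) (oplus_perm n p) = shift (- int j') (oplus_perm n p')"
        for p j p' j'
      proof -
        have jj: "j = j'"
          using shift_oplus_perm_le[OF lp lp n, of p p' j' j]
            shift_oplus_perm_le[OF lp lp n, of p' p j j'] * by simp
        have "oplus_perm n p = shift (int j) (shift (- int j) (oplus_perm n p))"
          by (simp add: shift_shift)
        also have "\<dots> = oplus_perm n p'"
          unfolding *(5) by (simp add: jj shift_shift)
        finally show ?thesis
          using oplus_perm_inj lp * jj by blast
      qed
      then show ?thesis
        by (auto simp: inj_on_def)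
    qed
    show "?f ` (SIGMA p:level C n. {..<first_block p}) = oplus_level C n"
    proof safe
      fix p j
      assume "p \<in> level C n"
      then show "shift (- int j) (oplus_perm n p) \<in> oplus_level C n"
        by (auto simp: oplus_level_def)
    next
      fix f
      assume "f \<in> oplus_level C n"
      then obtain r p where f: "f = shift r (oplus_perm n p)" and p: "p \<in> level C n"
        by (auto simp: oplus_level_def)
      \<comment> \<open>Shifts by multiples of \<open>n\<close> act trivially, so \<open>r\<close>
        may be replaced by \<open>- int q\<close> with \<open>q\<close> natural, the form required
        by the normal form.\<close>
      define q where "q = nat ((- r) mod int n)"
      have "- r = int q + (- r) div int n * int n"
        using n div_mult_mod_eq[of "- r" "int n"] by (simp add: q_def)
      then have "r = - int q + (- ((- r) div int n)) * int n"
        by (metis add.inverse_inverse minus_add_distrib mult_minus_left)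
      then have "f = shift (- int q) (shift ((- ((- r) div int n)) * int n) (oplus_perm n p))"
        unfolding f shift_shift by metis
      then have "f = shift (- int q) (oplus_perm n p)"
        unfolding shift_multiple_oplus_perm[OF n] .
      then obtain p' j where "p' \<in> level C n" "j < first_block p'"
        "f = shift (- int j) (oplus_perm n p')"
        using shift_oplus_perm_normal_form[OF C n p] by metis
      then show "f \<in> ?f ` (SIGMA p:level C n. {..<first_block p})"
        by (intro image_eqI[of _ _ "(p', j)"]) auto
    qed
  qed
  then have "card (oplus_level C n) = card (SIGMA p:level C n. {..<first_block p})"
    by (simp add: bij_betw_same_card)
  then show ?thesis
    by (simp add: card_SigmaI finite_level[OF C(1)])
qed

section \<open>Generating functions\<close>

text \<open>Chain rule: the derivative of log(1 + x) is 1/(1 + x), and substituting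
  \<open>F - 1\<close> for x turns it into \<open>inverse F\<close>.\<close>

lemma fps_deriv_fps_log:
  fixes F :: "'a::field_char_0 fps"
  assumes "fps_nth F 0 = 1"
  shows "fps_deriv (fps_log F) = fps_deriv F / F"
proof -
  have F: "fps_nth (F - 1) 0 = 0" using assms by simp
  have "inverse (1 + fps_X) oo (F - 1) = inverse F"
    using fps_inverse_compose[OF F, of "1 + fps_X"] F by (simp add: fps_compose_add_distrib)
  then show ?thesis
    unfolding fps_log_def
    by (simp add: fps_compose_deriv[OF F] fps_ln_deriv fps_divide_unit assms mult.commute)
qed

theorem theorem2p4:
  fixes C :: "sized_perm set" and F Ft G :: "rat fps"
  assumes "perm_class C" and "sum_closed C"
    and "F = Abs_fps (\<lambda>n. of_nat (card (level C n)))"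
    and "Ft = Abs_fps (\<lambda>n. if n = 0 then 0 else of_nat (card (oplus_level C n)))"
    and "G = Abs_fps (\<lambda>n. if n = 0 then 0
                           else of_nat (card {p \<in> level C n. indecomposable (n, p)}))"
  shows "Ft = fps_X * fps_deriv G * F
       \<and> fps_X * fps_deriv G * F = fps_X * fps_deriv F / F
       \<and> fps_X * fps_deriv F / F = fps_X * fps_deriv (fps_log F)"
proof -
  note C = assms(1,2)
  have F0: "fps_nth F 0 = 1"
    by (simp add: assms(3) level_0[OF C(1)])
  \<comment> \<open>The 1 accounts for the empty permutation; in positive size the first block
    contributes the factor \<open>G\<close> and the remainder the factor \<open>F\<close>.\<close>
  have FG: "F = 1 + G * F"
  proof (rule fps_ext)
    fix n
    show "fps_nth F n = fps_nth (1 + G * F) n"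
    proof (cases "n = 0")
      case True
      then show ?thesis using F0 by (simp add: assms(5))
    next
      case False
      then have "fps_nth F n = (\<Sum>k=1..n. fps_nth G k * fps_nth F (n - k))"
        using sum_first_block[OF C, of n "\<lambda>_. 1 :: rat"] by (simp add: assms(3,5))
      also have "\<dots> = (\<Sum>k=0..n. fps_nth G k * fps_nth F (n - k))"
        by (rule sum.mono_neutral_left) (auto simp: assms(5))
      finally show ?thesis using False by (simp add: fps_mult_nth)
    qed
  qed
  have "Ft = fps_X * fps_deriv G * F"
  proof (rule fps_ext)
    fix n
    have XG: "fps_nth (fps_X * fps_deriv G) k = of_nat k * fps_nth G k" for k
      by (cases k) auto
    show "fps_nth Ft n = fps_nth (fps_X * fps_deriv G * F) n"
    proof (cases "n = 0")
      case True
      then show ?thesis by (simp add: assms(4))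
    next
      case False
      \<comment> \<open>Summing first blocks weights each indecomposable block by its size
        \<open>k\<close>, which is the effect of x d/dx on \<open>G\<close>.\<close>
      then have "fps_nth Ft n = (\<Sum>p\<in>level C n. of_nat (first_block p))"
        by (simp add: assms(4) card_oplus_level[OF C])
      also have "\<dots> = (\<Sum>k=1..n. of_nat k * fps_nth G k * fps_nth F (n - k))"
        using sum_first_block[OF C, of n "of_nat :: nat \<Rightarrow> rat"] False
        by (simp add: assms(3,5) mult.assoc)
      also have "\<dots> = (\<Sum>k=0..n. of_nat k * fps_nth G k * fps_nth F (n - k))"
        by (rule sum.mono_neutral_left) auto
      finally show ?thesis unfolding fps_mult_nth[of _ F] XG .
    qed
  qed
  moreover have "fps_X * fps_deriv G * F = fps_X * fps_deriv F / F"
  proof -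
    \<comment> \<open>Differentiating \<open>F = 1 + G * F\<close> and cancelling
      \<open>1 - G\<close>, the inverse of \<open>F\<close>, gives F' = G' F^2; dividing by
      \<open>F\<close> finishes.\<close>
    have "fps_deriv F = fps_deriv G * F + G * fps_deriv F"
      using arg_cong[OF FG, of fps_deriv] by (simp add: algebra_simps)
    then have "fps_deriv F * (1 - G) = fps_deriv G * F"
      by (simp add: algebra_simps)
    moreover have "(1 - G) * F = 1"
      using FG by (simp add: algebra_simps)
    ultimately have "fps_deriv F = fps_deriv G * F * F"
      by (metis mult.assoc mult.right_neutral)
    moreover have "F * inverse F = 1"
      using F0 by (simp add: inverse_mult_eq_1')
    ultimately show ?thesis
      using F0 by (simp add: fps_divide_unit mult.assoc)
  qed
  moreover have "fps_X * fps_deriv F / F = fps_X * fps_deriv (fps_log F)"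
    using F0 by (simp add: fps_deriv_fps_log fps_divide_unit mult.assoc)
  ultimately show ?thesis by blast
qed

end
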